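(* Let $q=3^n$ with $n$ a positive integer and let $\alpha,\beta,\gamma,\theta\in\mathbb{F}_{3^n}^*$. Let $$f(x)=(\beta-\alpha)x^{\frac{q-1}{2}+3}+(\beta\theta-\alpha\gamma)x^{\frac{q-1}{2}+2}+(\beta\theta^2-\alpha\gamma^2)x^{\frac{q-1}{2}+1}-(\beta+\alpha)x^3-(\beta\theta+\alpha\gamma)x^2-(\beta\theta^2+\alpha\gamma^2)x.$$ Then $f$ is a permutation polynomial of $\mathbb{F}_{3^n}$ if and only if $\eta(\alpha)=\eta(\beta)$, $\eta(\gamma)=-1$ and $\eta(\theta)=1$.
   Context: $\eta$ denotes the quadratic character of $\mathbb{F}_q$ ($\eta(a)=1$ if $a$ is a nonzero square, $-1$ if $a$ is a non-square). A polynomial is a permutation polynomial (PP) of a finite field if it induces a bijection of that field to itself. *)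

theory Defs
  imports
    "HOL-Computational_Algebra.Computational_Algebra"
    "HOL-Computational_Algebra.Nth_Powers"
    "HOL-Library.Cardinality"
begin

(* The value at 0 is the usual convention for extending a multiplicative character. *)
definition quadratic_character :: "'a :: finite_field \<Rightarrow> int" where
  "quadratic_character a = (if a = 0 then 0 else if is_square a then 1 else - 1)"

definition permutation_polynomial :: "'a :: finite_field poly \<Rightarrow> bool" where
  "permutation_polynomial f \<longleftrightarrow> bij (poly f)"

end

theory Submission
  imports Defs
begin

text \<open>
  Since \<open>x ^ ((q - 1) div 2)\<close> is the quadratic character of \<open>x\<close> and \<open>- 2 = 1\<close>,
  the polynomial equals \<open>\<alpha> * x * (x - \<gamma>)\<^sup>2\<close> on the nonzero squares and \<open>\<beta> * x * (x - \<theta>)\<^sup>2\<close> on the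
  nonsquares. So it has no nonzero root iff \<open>\<gamma>\<close> is a nonsquare and \<open>\<theta>\<close> is a square. In that case its
  values on the two classes have character \<open>\<eta>(\<alpha>)\<close> and \<open>- \<eta>(\<beta>)\<close>, which must differ for surjectivity.
  Injectivity on each class holds because \<open>x * (x - c)\<^sup>2 = y * (y - c)\<^sup>2\<close> with \<open>x \<noteq> y\<close> forces
  \<open>c * x = (x - y + c)\<^sup>2\<close> in characteristic 3.
\<close>

lemma power_half_card_cases:
  fixes x :: "'a :: finite_field"
  assumes "CARD('a) = 2 * m + 1" "x \<noteq> 0"
  shows "x ^ m = 1 \<or> x ^ m = - 1"
proof -
  have "x * x ^ (2 * m) = x * 1"
    using finite_field_power_card_eq_same[of x] assms(1) by simp
  hence "(x ^ m)\<^sup>2 = 1"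
    using assms(2) by (simp add: power_mult[symmetric] mult.commute)
  thus ?thesis by (simp add: power2_eq_1_iff)
qed

lemma card_power_eq_1_le:
  assumes "m > 0"
  shows "card {x :: 'a :: idom. x ^ m = 1} \<le> m"
proof -
  have "coeff (monom 1 m - 1 :: 'a poly) m \<noteq> 0" using assms by simp
  hence "(monom 1 m - 1 :: 'a poly) \<noteq> 0" by force
  hence "card {x :: 'a. poly (monom 1 m - 1) x = 0} \<le> degree (monom 1 m - 1 :: 'a poly)"
    by (rule card_poly_roots_bound)
  also have "\<dots> \<le> m"
    by (intro degree_diff_le) (auto simp: degree_monom_le)
  finally show ?thesis by (simp add: poly_monom)
qed

text \<open>Squaring is at most two-to-one on the 2 * m nonzero elements, so there are at least m
  nonzero squares. All of them are roots of X^m - 1, which has at most m roots, so the two sets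
  coincide.\<close>

lemma Euler_criterion_finite_field:
  fixes x :: "'a :: finite_field"
  assumes card: "CARD('a) = 2 * m + 1" and "m > 0" "x \<noteq> 0"
  shows "is_square x \<longleftrightarrow> x ^ m = 1"
proof -
  define S where "S = {x :: 'a. x \<noteq> 0 \<and> is_square x}"
  have sub: "S \<subseteq> {x. x ^ m = 1}"
  proof
    fix s assume "s \<in> S"
    then obtain y where y: "s = y\<^sup>2" "y \<noteq> 0" by (auto simp: S_def is_nth_power_def)
    have "s ^ m = (y ^ m)\<^sup>2" by (simp add: y power_mult[symmetric] mult.commute)
    thus "s \<in> {x. x ^ m = 1}" using power_half_card_cases[OF card y(2)] by auto
  qed
  have fibre: "card {y. y\<^sup>2 = s} \<le> 2" for s :: 'a
  proof (cases "\<exists>z. z\<^sup>2 = s")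
    case True
    then obtain z where "z\<^sup>2 = s" by blast
    hence "{y. y\<^sup>2 = s} \<subseteq> {z, - z}" by (auto simp: power2_eq_iff)
    hence "card {y. y\<^sup>2 = s} \<le> card {z, - z}" by (rule card_mono[rotated]) simp
    also have "\<dots> \<le> 2" by (simp add: card_insert_if)
    finally show ?thesis .
  qed auto
  have "UNIV - {0 :: 'a} \<subseteq> (\<Union>s\<in>S. {y. y\<^sup>2 = s})"
    by (auto simp: S_def)
  hence "card (UNIV - {0 :: 'a}) \<le> card (\<Union>s\<in>S. {y :: 'a. y\<^sup>2 = s})"
    by (rule card_mono[rotated]) auto
  also have "\<dots> \<le> (\<Sum>s\<in>S. card {y. y\<^sup>2 = s})" by (rule card_UN_le) simp
  also have "\<dots> \<le> card S * 2" using sum_bounded_above[of S "\<lambda>s. card {y. y\<^sup>2 = s}" 2] fibre by simp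
  finally have "m \<le> card S" using card by (simp add: card_Diff_singleton)
  hence "S = {x. x ^ m = 1}"
    using sub card_power_eq_1_le[OF \<open>m > 0\<close>, where 'a = 'a]
    by (intro card_seteq) auto
  thus ?thesis using \<open>x \<noteq> 0\<close> by (auto simp: S_def)
qed

text \<open>Otherwise all 2 * m nonzero elements would be roots of X^m - 1, twice as many as its
  degree.\<close>

lemma exists_power_half_card_eq_minus_1:
  assumes card: "CARD('a :: finite_field) = 2 * m + 1" and "m > 0"
  shows "\<exists>x :: 'a. x ^ m = - 1"
proof (rule ccontr)
  assume "\<not> ?thesis"
  hence "UNIV - {0 :: 'a} \<subseteq> {x. x ^ m = 1}"
    using power_half_card_cases[OF card] by auto
  hence "card (UNIV - {0 :: 'a}) \<le> card {x :: 'a. x ^ m = 1}"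
    by (rule card_mono[rotated]) auto
  thus False using card_power_eq_1_le[OF \<open>m > 0\<close>, where 'a = 'a] card \<open>m > 0\<close>
    by (simp add: card_Diff_singleton)
qed

text \<open>Translation by 1 permutes the field and so preserves the sum of all elements, yet it
  adds 1 once per element; hence \<open>3 ^ n\<close> vanishes in the field.\<close>

lemma three_eq_0_finite_field:
  assumes "CARD('a :: finite_field) = 3 ^ n"
  shows "(3 :: 'a) = 0"
proof -
  have "(\<Sum>x\<in>UNIV. x) = (\<Sum>x\<in>UNIV. x + 1 :: 'a)"
    by (rule sum.reindex_bij_witness[of _ "\<lambda>x. x + 1" "\<lambda>x. x - 1"]) auto
  also have "\<dots> = (\<Sum>x\<in>UNIV. x) + of_nat (3 ^ n)"
    using assms by (simp add: sum.distrib)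
  finally show ?thesis by simp
qed

lemma cubic_collision_char_3:
  fixes x y c :: "'a :: field"
  assumes "(3 :: 'a) = 0" "x \<noteq> y" "x * (x - c)\<^sup>2 = y * (y - c)\<^sup>2"
  shows "c * x = (x - y + c)\<^sup>2"
proof -
  \<comment> \<open>An identity in every commutative ring: the multiple of 3 is split off before the
    characteristic is used.\<close>
  have "(x - y) * (c * x - (x - y + c)\<^sup>2) =
          y * (y - c)\<^sup>2 - x * (x - c)\<^sup>2 + 3 * (x - y) * (x * y - c * x)"
    by algebra
  hence "(x - y) * (c * x - (x - y + c)\<^sup>2) = 0" using assms(1,3) by simp
  thus ?thesis using assms(2) by simp
qed

theorem theorem1p7:
  fixes \<alpha> \<beta> \<gamma> \<theta> :: "'a :: finite_field"
    and f :: "'a poly"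
    and q n :: nat
  assumes "n > 0"
    and "q = 3 ^ n"
    and "CARD('a) = q"
    and "\<alpha> \<noteq> 0" "\<beta> \<noteq> 0" "\<gamma> \<noteq> 0" "\<theta> \<noteq> 0"
    and "f = monom (\<beta> - \<alpha>) ((q - 1) div 2 + 3)
           + monom (\<beta> * \<theta> - \<alpha> * \<gamma>) ((q - 1) div 2 + 2)
           + monom (\<beta> * \<theta>\<^sup>2 - \<alpha> * \<gamma>\<^sup>2) ((q - 1) div 2 + 1)
           - monom (\<beta> + \<alpha>) 3
           - monom (\<beta> * \<theta> + \<alpha> * \<gamma>) 2
           - monom (\<beta> * \<theta>\<^sup>2 + \<alpha> * \<gamma>\<^sup>2) 1"
  shows "permutation_polynomial f \<longleftrightarrow>
           quadratic_character \<alpha> = quadratic_character \<beta> \<and>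
           quadratic_character \<gamma> = - 1 \<and>
           quadratic_character \<theta> = 1"
proof -
  define m where "m = (q - 1) div 2"
  have "odd q" "q > 1" using assms(1,2) by (auto simp: one_less_power simp del: One_nat_def)
  hence m: "q = 2 * m + 1" "m > 0" by (auto simp: m_def elim!: oddE)
  have card: "CARD('a) = 2 * m + 1" using assms(3) m(1) by simp
  have three: "(3 :: 'a) = 0" using three_eq_0_finite_field assms(2,3) by blast
  have neq: "(1 :: 'a) \<noteq> - 1"
  proof
    assume "(1 :: 'a) = - 1"
    hence "(2 :: 'a) = 0" by (simp add: eq_neg_iff_add_eq_0)
    moreover have "(3 :: 'a) = 2 + 1" by simp
    ultimately show False using three by simp
  qed
  note cases = power_half_card_cases[OF card]
  have qc: "quadratic_character x = (if x ^ m = 1 then 1 else - 1)" if "x \<noteq> 0" for x :: 'a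
    using that Euler_criterion_finite_field[OF card m(2) that]
    by (simp add: quadratic_character_def)
  have square: "(x\<^sup>2) ^ m = 1" if "x \<noteq> 0" for x :: 'a
    using Euler_criterion_finite_field[OF card m(2), of "x\<^sup>2"] that by simp

  have f_0: "poly f 0 = 0"
    by (simp add: assms(8) poly_monom)
  have f_sq: "poly f x = \<alpha> * (x * (x - \<gamma>)\<^sup>2)" if "x ^ m = 1" for x
  proof -
    \<comment> \<open>For \<open>x ^ m = 1\<close> the \<beta> terms cancel and the \<alpha> terms
      add up to a factor -2. The multiple of 3 accounts for -2 in place of 1 at x^3 and x.\<close>
    have "poly f x = \<alpha> * (x * (x - \<gamma>)\<^sup>2) - 3 * \<alpha> * (x ^ 3 + \<gamma>\<^sup>2 * x)"
      unfolding assms(8) m_def[symmetric] poly_add poly_diff poly_monom power_add that by algebra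
    thus ?thesis using three by simp
  qed
  have f_nsq: "poly f x = \<beta> * (x * (x - \<theta>)\<^sup>2)" if "x ^ m = - 1" for x
  proof -
    have "poly f x = \<beta> * (x * (x - \<theta>)\<^sup>2) - 3 * \<beta> * (x ^ 3 + \<theta>\<^sup>2 * x)"
      unfolding assms(8) m_def[symmetric] poly_add poly_diff poly_monom power_add that by algebra
    thus ?thesis using three by simp
  qed
  have chi_sq: "poly f x ^ m = \<alpha> ^ m" if "x ^ m = 1" "x \<noteq> \<gamma>" for x
    using that square[of "x - \<gamma>"] by (simp add: f_sq power_mult_distrib)
  have chi_nsq: "poly f x ^ m = - (\<beta> ^ m)" if "x ^ m = - 1" "x \<noteq> \<theta>" for x
    using that square[of "x - \<theta>"] by (simp add: f_nsq power_mult_distrib)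

  \<comment> \<open>The m-th power replaces the character: it is multiplicative and stays inside the
    field.\<close>
  have "bij (poly f) \<longleftrightarrow> \<alpha> ^ m = \<beta> ^ m \<and> \<gamma> ^ m = - 1 \<and> \<theta> ^ m = 1"
  proof
    assume bij: "bij (poly f)"
    have root: "x = 0" if "poly f x = 0" for x
      using bij_is_inj[OF bij] that f_0 by (metis injD)
    have \<gamma>: "\<gamma> ^ m = - 1"
      using root[of \<gamma>] f_sq[of \<gamma>] cases[of \<gamma>] assms(6) by auto
    have \<theta>: "\<theta> ^ m = 1"
      using root[of \<theta>] f_nsq[of \<theta>] cases[of \<theta>] assms(7) by auto
    have "\<alpha> ^ m = \<beta> ^ m"
    proof (rule ccontr)
      assume "\<alpha> ^ m \<noteq> \<beta> ^ m"
      hence ab: "- (\<beta> ^ m) = \<alpha> ^ m" using cases[OF assms(4)] cases[OF assms(5)] by auto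
      \<comment> \<open>A value that f will turn out to miss: 1 if \<alpha> is a nonsquare,
        otherwise any nonsquare.\<close>
      have "\<exists>z :: 'a. z ^ m = - (\<alpha> ^ m)"
        using cases[OF assms(4)] exists_power_half_card_eq_minus_1[OF card m(2)]
        by (auto intro: exI[of _ 1])
      then obtain z :: 'a where z: "z ^ m = - (\<alpha> ^ m)" by blast
      obtain x where x: "poly f x = z" using bij_is_surj[OF bij] by (metis surjD)
      have "z \<noteq> 0" using z m(2) assms(4) by (auto simp: zero_power)
      hence "x \<noteq> 0" using x f_0 by auto
      hence "poly f x ^ m = \<alpha> ^ m"
        using cases chi_sq chi_nsq ab \<gamma> \<theta> neq by metis
      hence "\<alpha> ^ m = - (\<alpha> ^ m)" using x z by simp
      thus False using cases[OF assms(4)] neq by fastforce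
    qed
    thus "\<alpha> ^ m = \<beta> ^ m \<and> \<gamma> ^ m = - 1 \<and> \<theta> ^ m = 1" using \<gamma> \<theta> by blast
  next
    assume chars: "\<alpha> ^ m = \<beta> ^ m \<and> \<gamma> ^ m = - 1 \<and> \<theta> ^ m = 1"
    \<comment> \<open>Equal values of f thus come from arguments of the same class, so injectivity
      only has to be checked within each class.\<close>
    have chi: "poly f x ^ m = \<alpha> ^ m * x ^ m" for x
    proof (cases "x = 0")
      case True
      thus ?thesis using f_0 m(2) by simp
    next
      case False
      hence "x ^ m = 1 \<and> x \<noteq> \<gamma> \<or> x ^ m = - 1 \<and> x \<noteq> \<theta>"
        using cases chars neq by metis
      thus ?thesis using chi_sq chi_nsq chars by auto
    qed
    \<comment> \<open>This serves both classes: c is \<gamma> for squares x and \<theta> for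
      nonsquares x. In either case \<open>c * x\<close> is a nonsquare, while a collision would make
      it a square.\<close>
    have collision: "x = y" if "x * (x - c)\<^sup>2 = y * (y - c)\<^sup>2" "c ^ m * x ^ m = - 1" for x y c :: 'a
    proof (rule ccontr)
      assume "x \<noteq> y"
      hence "(c * x) ^ m = ((x - y + c)\<^sup>2) ^ m" using cubic_collision_char_3[OF three] that(1) by metis
      \<comment> \<open>\<open>square\<close> needs a nonzero base; if \<open>x - y + c\<close> is
        0, the power is 0 because m > 0, which is not -1 either.\<close>
      thus False
        using that(2) square[of "x - y + c"] neq m(2)
        by (cases "x - y + c = 0") (auto simp: power_mult_distrib zero_power)
    qed
    have "inj (poly f)"
    proof (rule injI)
      fix x y assume eq: "poly f x = poly f y"
      have "\<alpha> ^ m * x ^ m = \<alpha> ^ m * y ^ m" using chi eq by metis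
      hence xy: "x ^ m = y ^ m" using assms(4) by simp
      consider "x = 0" | "x ^ m = 1" | "x ^ m = - 1" using cases by blast
      thus "x = y"
      proof cases
        case 1
        thus ?thesis using xy m(2) by (simp add: zero_power)
      next
        case 2
        thus ?thesis using eq xy f_sq chars assms(4) by (intro collision[of x \<gamma> y]) auto
      next
        case 3
        thus ?thesis using eq xy f_nsq chars assms(5) by (intro collision[of x \<theta> y]) auto
      qed
    qed
    thus "bij (poly f)" by (simp add: bij_def finite_UNIV_inj_surj)
  qed
  thus ?thesis
    using cases[OF assms(4)] cases[OF assms(5)] cases[OF assms(6)] neq
    by (auto simp: permutation_polynomial_def qc assms(4-7))
qed

end
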